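(* Let $S$ be a quasi-fundamental inverse semigroup with zero whose idempotent semilattice $E(S)$ is $0$-disjunctive, and let $K$ be a field. Let $I$ be the singular ideal of $K_0S$. Then the following are equivalent for an ideal $J$ of $K_0S$: (1) $J\cap S=\{0\}$; (2) $J\cap E(S)=\{0\}$; (3) $J\subseteq I$. Moreover, if $S$ is fundamental, then these are equivalent to: (4) the canonical mapping $S\to K_0S/J$ is injective; (5) the canonical mapping $E(S)\to K_0S/J$ is injective; and, consequently, $I$ is the unique largest ideal $J$ of $K_0S$ such that the canonical mapping $S\to K_0S/J$ is injective.
   Context: An inverse semigroup is a semigroup $S$ in which every $s$ has a unique $s^*$ with $ss^*s=s$ and $s^*ss^*=s^*$. $E(S)$ is the (commutative) subsemigroup of idempotents. The natural partial order is $s\le t$ iff $s=ts^*s$; on $E(S)$ it is a meet semilattice order with meet the product. $Z_S(E(S))$ is the centralizer of $E(S)$ in $S$. $S$ is fundamental if $Z_S(E(S))=E(S)$. $S$ with zero is quasi-fundamental if for every $0\ne s\in Z_S(E(S))$ there is $0\neq e\in E(S)$ with $e\le s$. A semilattice $E$ with zero is $0$-disjunctive if whenever $0\neq f<e$ there exists $0\neq g\le e$ with $fg=0$. The contracted algebra $K_0S$ is the $K$-algebra with basis $S\setminus\{0\}$ and multiplication extending that of $S$ (the zero of $S$ being identified with the zero of $K_0S$, so $S\subseteq K_0S$). Ideals are two-sided. An element $a\in K_0S$ is singular if for every $0\ne e\in E(S)$ there is $0\neq f\in E(S)$, $f\le e$, with $af=0$; the singular elements form a two-sided ideal, the singular ideal.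 *)

theory Defs
  imports Complex_Main "HOL-Library.Set_Algebras"
begin

section \<open>Inverse semigroups\<close>

class inverse_semigroup = semigroup_mult +
  assumes ex1_inverse: "\<exists>!t. s * t * s = s \<and> t * s * t = t"
begin

definition star :: "'a \<Rightarrow> 'a"
  where "star s = (THE t. s * t * s = s \<and> t * s * t = t)"

definition idempotents :: "'a set"
  where "idempotents = {e. e * e = e}"

definition natural_le :: "'a \<Rightarrow> 'a \<Rightarrow> bool"
  where "natural_le s t \<longleftrightarrow> s = t * star s * s"

definition centralizer :: "'a set \<Rightarrow> 'a set"
  where "centralizer X = {s. \<forall>x\<in>X. s * x = x * s}"

lemma star_inverse: "s * star s * s = s" "star s * s * star s = star s"
  using theI'[OF ex1_inverse[of s]] unfolding star_def by auto

lemma star_eqI: "s * t * s = s \<Longrightarrow> t * s * t = t \<Longrightarrow> star s = t"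
  using ex1_inverse[of s] star_inverse[of s] by blast

end

class inverse_semigroup_with_zero = inverse_semigroup + mult_zero

definition fundamental :: "'a::inverse_semigroup itself \<Rightarrow> bool"
  where "fundamental _ \<longleftrightarrow> centralizer (idempotents :: 'a set) = idempotents"

definition quasi_fundamental :: "'a::inverse_semigroup_with_zero itself \<Rightarrow> bool"
  where "quasi_fundamental _ \<longleftrightarrow>
    (\<forall>s::'a. s \<in> centralizer idempotents \<and> s \<noteq> 0 \<longrightarrow>
       (\<exists>e\<in>idempotents. e \<noteq> 0 \<and> natural_le e s))"

definition idempotents_zero_disjunctive :: "'a::inverse_semigroup_with_zero itself \<Rightarrow> bool"
  where "idempotents_zero_disjunctive _ \<longleftrightarrow>
    (\<forall>e\<in>idempotents. \<forall>f::'a\<in>idempotents. f \<noteq> 0 \<and> natural_le f e \<and> f \<noteq> e \<longrightarrow>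
       (\<exists>g\<in>idempotents. g \<noteq> 0 \<and> natural_le g e \<and> f * g = 0))"

section \<open>The contracted algebra\<close>

text \<open>Elements are finitely supported functions on \<open>S\<close> vanishing at the zero of \<open>S\<close>,
  that is, finite linear combinations of the nonzero elements of \<open>S\<close>.\<close>

typedef (overloaded) ('a, 'k) contracted_algebra =
  "{f :: 'a::inverse_semigroup_with_zero \<Rightarrow> 'k::field. finite {s. f s \<noteq> 0} \<and> f 0 = 0}"
  morphisms coeff Abs_contracted_algebra
  by (rule exI[of _ "\<lambda>_. 0"]) simp

setup_lifting type_definition_contracted_algebra

definition support :: "('a::inverse_semigroup_with_zero, 'k::field) contracted_algebra \<Rightarrow> 'a set"
  where "support a = {s. coeff a s \<noteq> 0}"

instantiation contracted_algebra :: (inverse_semigroup_with_zero, field) ab_group_add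
begin

lift_definition zero_contracted_algebra :: "('a, 'b) contracted_algebra" is "\<lambda>_. 0" by simp

lift_definition plus_contracted_algebra ::
  "('a, 'b) contracted_algebra \<Rightarrow> ('a, 'b) contracted_algebra \<Rightarrow> ('a, 'b) contracted_algebra"
  is "\<lambda>f g s. f s + g s"
proof -
  fix f g :: "'a \<Rightarrow> 'b"
  assume "finite {s. f s \<noteq> 0} \<and> f 0 = 0" "finite {s. g s \<noteq> 0} \<and> g 0 = 0"
  moreover have "{s. f s + g s \<noteq> 0} \<subseteq> {s. f s \<noteq> 0} \<union> {s. g s \<noteq> 0}"
    by auto
  ultimately show "finite {s. f s + g s \<noteq> 0} \<and> f 0 + g 0 = 0"
    by (simp add: finite_subset)
qed

lift_definition uminus_contracted_algebra ::
  "('a, 'b) contracted_algebra \<Rightarrow> ('a, 'b) contracted_algebra"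
  is "\<lambda>f s. - f s" by simp

lift_definition minus_contracted_algebra ::
  "('a, 'b) contracted_algebra \<Rightarrow> ('a, 'b) contracted_algebra \<Rightarrow> ('a, 'b) contracted_algebra"
  is "\<lambda>f g s. f s - g s"
proof -
  fix f g :: "'a \<Rightarrow> 'b"
  assume "finite {s. f s \<noteq> 0} \<and> f 0 = 0" "finite {s. g s \<noteq> 0} \<and> g 0 = 0"
  moreover have "{s. f s - g s \<noteq> 0} \<subseteq> {s. f s \<noteq> 0} \<union> {s. g s \<noteq> 0}"
    by auto
  ultimately show "finite {s. f s - g s \<noteq> 0} \<and> f 0 - g 0 = 0"
    by (simp add: finite_subset)
qed

instance by standard (transfer; simp add: fun_eq_iff algebra_simps)+

end

lift_definition scale :: "'k \<Rightarrow> ('a::inverse_semigroup_with_zero, 'k::field) contracted_algebra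
    \<Rightarrow> ('a, 'k) contracted_algebra"
  is "\<lambda>c f s. c * f s" by simp

global_interpretation contracted_algebra: vector_space scale
  by standard (transfer; simp add: fun_eq_iff algebra_simps)+

text \<open>The inclusion of \<open>S\<close>; the zero of \<open>S\<close> is sent to the zero of the algebra.\<close>

lift_definition incl :: "'a::inverse_semigroup_with_zero \<Rightarrow> ('a, 'k::field) contracted_algebra"
  is "\<lambda>t s. if s = t \<and> t \<noteq> 0 then 1 else 0" by auto

instantiation contracted_algebra :: (inverse_semigroup_with_zero, field) times
begin

definition times_contracted_algebra ::
  "('a, 'b) contracted_algebra \<Rightarrow> ('a, 'b) contracted_algebra \<Rightarrow> ('a, 'b) contracted_algebra"
  where "a * b =
    (\<Sum>s\<in>support a. \<Sum>t\<in>support b. scale (coeff a s * coeff b t) (incl (s * t)))"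

instance ..

end

lemma finite_support [simp]: "finite (support a)"
  unfolding support_def using coeff[of a] by simp

lemma incl_0 [simp]: "incl 0 = 0"
  by transfer auto

lemma coeff_eqI: "(\<And>s. coeff a s = coeff b s) \<Longrightarrow> a = b"
  by (simp add: coeff_inject[symmetric] fun_eq_iff)

lemma coeff_simps [simp]:
  "coeff 0 s = 0" "coeff (a + b) s = coeff a s + coeff b s"
  "coeff (- a) s = - coeff a s" "coeff (a - b) s = coeff a s - coeff b s"
  "coeff (scale c a) s = c * coeff a s" "coeff a 0 = 0"
  by (transfer; simp)+

lemma coeff_incl: "coeff (incl t) s = (if s = t \<and> t \<noteq> 0 then 1 else 0)"
  by transfer simp

lemma coeff_sum: "coeff (sum h A) s = (\<Sum>x\<in>A. coeff (h x) s)"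
  by (induction A rule: infinite_finite_induct) auto

lemma times_superset:
  assumes "finite A" "support a \<subseteq> A" "finite B" "support b \<subseteq> B"
  shows "a * b = (\<Sum>s\<in>A. \<Sum>t\<in>B. scale (coeff a s * coeff b t) (incl (s * t)))"
proof -
  have "a * b = (\<Sum>s\<in>support a. \<Sum>t\<in>B. scale (coeff a s * coeff b t) (incl (s * t)))"
    unfolding times_contracted_algebra_def
    by (intro sum.cong refl sum.mono_neutral_left assms) (auto simp: support_def)
  also have "\<dots> = (\<Sum>s\<in>A. \<Sum>t\<in>B. scale (coeff a s * coeff b t) (incl (s * t)))"
    by (intro sum.mono_neutral_left assms) (auto simp: support_def)
  finally show ?thesis .
qed

lemma contracted_distrib_right:
  fixes a b c :: "('a::inverse_semigroup_with_zero, 'k::field) contracted_algebra"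
  shows "(a + b) * c = a * c + b * c"
proof -
  let ?A = "support a \<union> support b \<union> support (a + b)"
  have "d * c = (\<Sum>s\<in>?A. \<Sum>t\<in>support c. scale (coeff d s * coeff c t) (incl (s * t)))"
    if "d \<in> {a, b, a + b}" for d
    using that by (intro times_superset) auto
  then show ?thesis
    by (simp add: sum.distrib[symmetric] contracted_algebra.scale_left_distrib algebra_simps)
qed

lemma contracted_distrib_left:
  fixes a b c :: "('a::inverse_semigroup_with_zero, 'k::field) contracted_algebra"
  shows "c * (a + b) = c * a + c * b"
proof -
  let ?A = "support a \<union> support b \<union> support (a + b)"
  have "c * d = (\<Sum>s\<in>support c. \<Sum>t\<in>?A. scale (coeff c s * coeff d t) (incl (s * t)))"
    if "d \<in> {a, b, a + b}" for d
    using that by (intro times_superset) auto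
  then show ?thesis
    by (simp add: sum.distrib[symmetric] contracted_algebra.scale_left_distrib algebra_simps)
qed

lemma contracted_scale_times:
  fixes a b :: "('a::inverse_semigroup_with_zero, 'k::field) contracted_algebra"
  shows "scale c a * b = scale c (a * b)" "a * scale c b = scale c (a * b)"
proof -
  have "support (scale c d) \<subseteq> support d" for d :: "('a, 'k) contracted_algebra"
    by (auto simp: support_def)
  then show "scale c a * b = scale c (a * b)" "a * scale c b = scale c (a * b)"
    by (simp_all add: times_superset[of "support a" _ "support b"]
          contracted_algebra.scale_sum_right mult_ac)
qed

lemma incl_mult: "incl (s * t) = (incl s * incl t
    :: ('a::inverse_semigroup_with_zero, 'k::field) contracted_algebra)"
  by (subst times_superset[of "{s}" _ "{t}"]) (auto simp: support_def coeff_incl)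

lemma contracted_expand: "a = (\<Sum>s\<in>support a. scale (coeff a s) (incl s))"
proof (rule coeff_eqI)
  fix s
  have "(\<Sum>t\<in>support a. coeff a t * coeff (incl t :: ('a, 'b) contracted_algebra) s)
      = (\<Sum>t\<in>support a. if s = t then coeff a t else 0)"
    by (intro sum.cong) (auto simp: coeff_incl)
  then show "coeff a s = coeff (\<Sum>s\<in>support a. scale (coeff a s) (incl s)) s"
    by (simp add: coeff_sum sum.delta) (simp add: support_def)
qed

lemma contracted_times_zero:
  fixes a :: "('a::inverse_semigroup_with_zero, 'k::field) contracted_algebra"
  shows "a * 0 = 0" "0 * a = 0"
  by (simp_all add: times_contracted_algebra_def)

lemma contracted_sum_distrib:
  fixes a :: "('a::inverse_semigroup_with_zero, 'k::field) contracted_algebra"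
  shows "a * sum h X = (\<Sum>x\<in>X. a * h x)" "sum h X * a = (\<Sum>x\<in>X. h x * a)"
  by (induction X rule: infinite_finite_induct)
    (auto simp: contracted_times_zero contracted_distrib_left contracted_distrib_right)

lemma contracted_assoc:
  fixes a b c :: "('a::inverse_semigroup_with_zero, 'k::field) contracted_algebra"
  shows "a * b * c = a * (b * c)"
proof -
  have 1: "incl s * incl t * incl u = incl s * (incl t * incl u :: ('a, 'k) contracted_algebra)"
    for s t u by (simp only: incl_mult[symmetric] mult.assoc)
  have 2: "incl s * incl t * c = incl s * (incl t * c)" for s t
  proof -
    have "incl s * incl t * (\<Sum>u\<in>support c. scale (coeff c u) (incl u))
        = incl s * (incl t * (\<Sum>u\<in>support c. scale (coeff c u) (incl u)))"
      by (simp only: contracted_sum_distrib contracted_scale_times 1)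
    then show ?thesis by (simp only: contracted_expand[symmetric])
  qed
  have 3: "incl s * b * c = incl s * (b * c)" for s
  proof -
    have "incl s * (\<Sum>u\<in>support b. scale (coeff b u) (incl u)) * c
        = incl s * ((\<Sum>u\<in>support b. scale (coeff b u) (incl u)) * c)"
      by (simp only: contracted_sum_distrib contracted_scale_times 2)
    then show ?thesis by (simp only: contracted_expand[symmetric])
  qed
  have "(\<Sum>u\<in>support a. scale (coeff a u) (incl u)) * b * c
      = (\<Sum>u\<in>support a. scale (coeff a u) (incl u)) * (b * c)"
    by (simp only: contracted_sum_distrib contracted_scale_times 3)
  then show ?thesis by (simp only: contracted_expand[symmetric])
qed

instance contracted_algebra :: (inverse_semigroup_with_zero, field) ring
  by standard (simp_all add: contracted_assoc contracted_distrib_left contracted_distrib_right)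

section \<open>Ideals\<close>

text \<open>The algebra need not have a unit, so ideals are explicitly required to be
  \<open>K\<close>-subspaces.  Since it has local units, this is no restriction on
  ring-theoretic two-sided ideals.\<close>

definition two_sided_ideal ::
    "('a::inverse_semigroup_with_zero, 'k::field) contracted_algebra set \<Rightarrow> bool"
  where "two_sided_ideal J \<longleftrightarrow>
    contracted_algebra.subspace J \<and> (\<forall>a. \<forall>x\<in>J. a * x \<in> J \<and> x * a \<in> J)"

definition singular :: "('a::inverse_semigroup_with_zero, 'k::field) contracted_algebra \<Rightarrow> bool"
  where "singular a \<longleftrightarrow>
    (\<forall>e\<in>idempotents. e \<noteq> 0 \<longrightarrow>
       (\<exists>f\<in>idempotents. f \<noteq> 0 \<and> natural_le f e \<and> a * incl f = 0))"

definition singular_ideal :: "('a::inverse_semigroup_with_zero, 'k::field) contracted_algebra set"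
  where "singular_ideal = {a. singular a}"

text \<open>The canonical map from \<open>S\<close> to the quotient by \<open>J\<close>, whose elements are the cosets of \<open>J\<close>.\<close>

definition canonical_map ::
    "('a::inverse_semigroup_with_zero, 'k::field) contracted_algebra set
      \<Rightarrow> 'a \<Rightarrow> ('a, 'k) contracted_algebra set"
  where "canonical_map J s = incl s +o J"

end

theory Submission
  imports Defs
begin

section \<open>Inverse semigroups\<close>

text \<open>View \<open>s\<close> as a partial bijection with domain idempotent
  \<open>star s * s\<close>; multiplying \<open>a\<close> on the right by \<open>incl f\<close>
  restricts it to \<open>f\<close>. An ideal containing \<open>s\<close> contains
  \<open>star s * s\<close>, so avoiding the semigroup and avoiding its idempotents amount to the
  same. A nonzero idempotent \<open>e\<close> is never singular, since it acts as the identity on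
  every nonzero \<open>f\<close> below it.

  The heart is \<open>ideal_subset_singular_ideal\<close>. If \<open>a\<close> in \<open>J\<close>
  vanishes on no nonzero idempotent below \<open>e\<close>, restrict it so that as few terms as
  possible remain. These terms then share one domain \<open>f\<close>, and no two agree on a nonzero
  idempotent below \<open>f\<close>. For a term \<open>s\<close>,
  \<open>displaced_idempotent_finite\<close> gives a nonzero \<open>h\<close> with
  \<open>h * (star s * t) * h = 0\<close> for all other terms \<open>t\<close>; compressing by
  \<open>h\<close> isolates a nonzero multiple of \<open>incl h\<close> in \<open>J\<close>. Here
  0-disjunctivity makes every element that fails to centralize the idempotents displace one
  (\<open>displaced_idempotent\<close>), and quasi-fundamentality handles the elements that do
  centralize them (\<open>displaced_idempotent_below\<close>).

  In the fundamental case distinct elements stay distinct modulo the singular ideal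
  (\<open>singular_diff_imp_eq\<close>). Conversely, injectivity on idempotents keeps nonzero
  idempotents out of \<open>J\<close>, because these would be identified with zero.\<close>

context inverse_semigroup
begin

section \<open>Idempotents, inverses and restrictions\<close>

lemma idempotentsD: "e \<in> idempotents \<Longrightarrow> e * e = e"
  by (simp add: idempotents_def)

lemma idempotents_absorb: "e \<in> idempotents \<Longrightarrow> e * (e * x) = e * x"
  by (simp add: idempotents_def mult.assoc[symmetric])

lemma star_assoc:
  "s * (star s * s) = s" "star s * (s * star s) = star s"
  "s * (star s * (s * x)) = s * x" "star s * (s * (star s * x)) = star s * x"
  using star_inverse[of s] by (simp_all add: mult.assoc[symmetric])

lemma star_star [simp]: "star (star s) = s"
  by (rule star_eqI) (simp_all add: star_inverse)

lemma star_idempotent: "e \<in> idempotents \<Longrightarrow> star e = e"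
  by (rule star_eqI) (simp_all add: idempotents_def)

lemma star_mult_idempotent [simp]: "star s * s \<in> idempotents" "s * star s \<in> idempotents"
  by (simp_all add: idempotents_def mult.assoc star_assoc)

text \<open>With \<open>x\<close> the inverse of \<open>e * f\<close>, the product
  \<open>f * x * e\<close> is an inverse of \<open>e * f\<close> too, so uniqueness gives
  \<open>x = f * x * e\<close>, which is idempotent. An idempotent is its own inverse, hence
  \<open>e * f = star x = x\<close>.\<close>

lemma idempotents_mult [intro]:
  assumes "e \<in> idempotents" "f \<in> idempotents"
  shows "e * f \<in> idempotents"
proof -
  define x where "x = star (e * f)"
  note ab = idempotents_absorb[OF assms(1)] idempotents_absorb[OF assms(2)]
  have x: "e * (f * (x * (e * f))) = e * f" "x * (e * (f * x)) = x"
    "x * (e * (f * (x * y))) = x * y" for y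
    using star_inverse[of "e * f"] unfolding x_def by (simp_all add: mult.assoc[symmetric])
  have "x = f * x * e"
    unfolding x_def by (rule star_eqI) (simp_all add: mult.assoc ab x x_def[symmetric])
  moreover have "f * x * e * (f * x * e) = f * x * e"
    by (simp add: mult.assoc x)
  ultimately have "x * x = x"
    by simp
  then have "star x = x"
    by (intro star_idempotent) (simp add: idempotents_def)
  then show ?thesis
    using \<open>x * x = x\<close> by (simp add: x_def idempotents_def)
qed

text \<open>Both products are idempotent, so \<open>f * e\<close> is an inverse of
  \<open>e * f\<close>; but \<open>e * f\<close> is its own inverse.\<close>

lemma idempotents_commute:
  assumes "e \<in> idempotents" "f \<in> idempotents"
  shows "e * f = f * e"
proof -
  note ab = idempotents_absorb[OF assms(1)] idempotents_absorb[OF assms(2)]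
  have "e * (f * (e * f)) = e * f" "f * (e * (f * e)) = f * e"
    using idempotentsD[OF idempotents_mult[OF assms]]
      idempotentsD[OF idempotents_mult[OF assms(2,1)]] by (simp_all add: mult.assoc)
  then have "star (e * f) = f * e"
    by (intro star_eqI) (simp_all add: mult.assoc ab)
  then show ?thesis
    using star_idempotent[OF idempotents_mult[OF assms]] by simp
qed

lemma star_mult: "star (s * t) = star t * star s"
proof (rule star_eqI)
  have c: "t * (star t * (star s * (s * x))) = star s * (s * (t * (star t * x)))" for x
    using idempotents_commute[of "t * star t" "star s * s"]
    by (simp add: mult.assoc[symmetric])
  show "s * t * (star t * star s) * (s * t) = s * t"
    by (simp add: mult.assoc c star_assoc)
  show "star t * star s * (s * t) * (star t * star s) = star t * star s"
    by (simp add: mult.assoc c[symmetric] star_assoc)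
qed

lemma conjugate_idempotent:
  assumes "e \<in> idempotents"
  shows "s * e * star s \<in> idempotents" "star s * e * s \<in> idempotents"
proof -
  have "t * e * star t \<in> idempotents" for t
  proof -
    have c: "e * (star t * (t * x)) = star t * (t * (e * x))" for x
      using idempotents_commute[OF assms, of "star t * t"] by (simp add: mult.assoc[symmetric])
    show ?thesis
      by (simp add: idempotents_def mult.assoc c star_assoc idempotents_absorb[OF assms])
  qed
  from this[of s] this[of "star s"] show "s * e * star s \<in> idempotents" "star s * e * s \<in> idempotents"
    by simp_all
qed

lemma natural_le_idempotents:
  assumes "e \<in> idempotents" "f \<in> idempotents"
  shows "natural_le f e \<longleftrightarrow> f * e = f"
proof -
  have "natural_le f e \<longleftrightarrow> f = e * f"
    using assms(2) by (simp add: natural_le_def star_idempotent idempotentsD mult.assoc)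
  then show ?thesis
    using idempotents_commute[OF assms] by auto
qed

text \<open>A restriction with the same domain is not proper. Moving \<open>p\<close> through
  \<open>t\<close> turns it into \<open>j = star t * p * t\<close> on the right, and equality of the
  domains makes \<open>j\<close> act trivially there.\<close>

lemma eq_if_restriction:
  assumes "p \<in> idempotents" "s = p * t" "star s * s = star t * t"
  shows "s = t"
proof -
  have pt: "p * (t * star t) = t * star t * p"
    using assms(1) by (simp add: idempotents_commute)
  define j where "j = star t * p * t"
  have j: "j \<in> idempotents"
    unfolding j_def using assms(1) by (rule conjugate_idempotent)
  have "p * t = t * j"
    unfolding j_def by (metis pt mult.assoc star_inverse(1))
  then have s: "s = t * j"
    using assms(2) by simp
  then have "star s * s * j = star s * s"
    using j by (simp add: mult.assoc idempotentsD)
  then have "t * (star s * s) = t * j * (star s * s)"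
    using j by (metis idempotents_commute mult.assoc star_mult_idempotent(1))
  then show ?thesis
    using s assms(3) by (metis mult.assoc star_inverse(1))
qed

end

text \<open>\<open>s * e\<close> is recovered from the conjugate as
  \<open>s * e * star s * (s * e)\<close>.\<close>

lemma conjugate_eq_0_iff:
  fixes s :: "'a::inverse_semigroup_with_zero"
  assumes "e \<in> idempotents"
  shows "s * e * star s = 0 \<longleftrightarrow> s * e = 0"
proof
  assume "s * e * star s = 0"
  then have "s * e * star s * (s * e) = 0"
    by simp
  moreover have "s * e * star s * (s * e) = s * e"
    using star_inverse(1)[of "s * e"] assms
    by (simp add: star_mult star_idempotent mult.assoc idempotents_absorb)
  ultimately show "s * e = 0"
    by simp
qed simp

lemma zero_idempotent [simp]: "(0::'a::inverse_semigroup_with_zero) \<in> idempotents"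
  by (simp add: idempotents_def)

lemma star_zero [simp]: "star (0::'a::inverse_semigroup_with_zero) = 0"
  by (simp add: star_idempotent)

section \<open>0-disjunctivity and displaced idempotents\<close>

text \<open>The form used below: \<open>f\<close> need not lie under \<open>e\<close>. Apply the
  definition to \<open>f * e\<close>, or take \<open>g = e\<close> if that product is zero.\<close>

lemma zero_disjunctiveE:
  fixes e f :: "'a::inverse_semigroup_with_zero"
  assumes "idempotents_zero_disjunctive TYPE('a)"
    and "e \<in> idempotents" "f \<in> idempotents" "f * e \<noteq> e"
  obtains g where "g \<in> idempotents" "g \<noteq> 0" "g * e = g" "f * g = 0"
proof (cases "f * e = 0")
  case True
  then show thesis
    using that[of e] assms by (auto simp: idempotentsD)
next
  case False
  have "natural_le (f * e) e"
    using assms by (auto simp: natural_le_idempotents idempotents_mult mult.assoc idempotentsD)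
  then obtain g where g: "g \<in> idempotents" "g \<noteq> 0" "natural_le g e" "f * e * g = 0"
    using assms False unfolding idempotents_zero_disjunctive_def by (metis idempotents_mult)
  then have "g * e = g"
    using assms by (simp add: natural_le_idempotents)
  moreover from this have "f * g = 0"
    using g assms by (metis idempotents_commute mult.assoc)
  ultimately show thesis
    using that g by blast
qed

text \<open>An element which moves the idempotent \<open>k\<close> displaces some nonzero idempotent \<open>h\<close>
  off itself: 0-disjunctivity yields a part of \<open>x * k * star x\<close> orthogonal to \<open>k\<close>, and \<open>h\<close> is
  its preimage.\<close>

lemma displaced_idempotent_right:
  fixes x k :: "'a::inverse_semigroup_with_zero"
  assumes "idempotents_zero_disjunctive TYPE('a)"
    and k: "k \<in> idempotents" and ne: "x * k \<noteq> k * x * k"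
  obtains h where "h \<in> idempotents" "h \<noteq> 0" "h * x * h = 0" "h * (star x * x) = h"
proof -
  \<comment> \<open>\<open>r\<close> is the range idempotent of \<open>x * k\<close>, so
    \<open>x * k\<close> is also the restriction \<open>r * x\<close>.\<close>
  define r where "r = x * k * star x"
  have r: "r \<in> idempotents"
    unfolding r_def using k by (rule conjugate_idempotent)
  have rx: "r * x = x * k"
    unfolding r_def using idempotents_commute[OF k, of "star x * x"]
    by (simp add: mult.assoc star_assoc)
  have rxx: "r * (x * star x) = r"
    unfolding r_def by (simp add: mult.assoc star_assoc)
  have "k * r \<noteq> r"
    using ne rx by (metis mult.assoc)
  then obtain l where l: "l \<in> idempotents" "l \<noteq> 0" "l * r = l" "k * l = 0"
    using zero_disjunctiveE assms(1) r k by blast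
  define h where "h = star x * l * x"
  have lx: "l * x * k = l * x"
    using rx l(3) k by (metis mult.assoc idempotentsD)
  have lxx: "l * (x * star x) = l"
    using rxx l(3) by (metis mult.assoc)
  have h: "h \<in> idempotents"
    unfolding h_def using l(1) by (rule conjugate_idempotent)
  have hk: "h * k = h"
    unfolding h_def using lx by (simp add: mult.assoc)
  have xh: "x * h = l * x"
    unfolding h_def using lxx idempotents_commute[OF l(1), of "x * star x"]
    by (simp add: mult.assoc[symmetric])
  have "h \<noteq> 0"
    using xh lxx l(2) by (metis mult.assoc mult_zero_left mult_zero_right)
  moreover have "h * x * h = 0"
    using xh hk l(4) by (metis mult.assoc mult_zero_left mult_zero_right)
  moreover have "h * (star x * x) = h"
    unfolding h_def by (simp add: mult.assoc star_assoc)
  ultimately show thesis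
    using that h by blast
qed

text \<open>If \<open>x * k = k * x * k\<close>, the failure to commute lies on the other side. Then
  \<open>star x\<close> satisfies the hypothesis of the one-sided version, and \<open>star\<close>
  carries the conclusion back to \<open>x\<close>, exchanging domain and range.\<close>

lemma displaced_idempotent:
  fixes x k :: "'a::inverse_semigroup_with_zero"
  assumes "idempotents_zero_disjunctive TYPE('a)"
    and k: "k \<in> idempotents" and ne: "x * k \<noteq> k * x"
  obtains h where "h \<in> idempotents" "h \<noteq> 0" "h * x * h = 0"
    "h * (star x * x) = h \<or> h * (x * star x) = h"
proof (cases "x * k = k * x * k")
  case False
  then show thesis
    using displaced_idempotent_right[OF assms(1) k] that by metis
next
  case True
  have "star x * k \<noteq> k * star x * k"
  proof
    assume "star x * k = k * star x * k"
    moreover have "star (star x * k) = k * x" "star (k * star x * k) = k * x * k"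
      using k by (simp_all add: star_mult star_idempotent mult.assoc)
    ultimately show False
      using True ne by metis
  qed
  then obtain h where h: "h \<in> idempotents" "h \<noteq> 0" "h * star x * h = 0" "h * (x * star x) = h"
    using displaced_idempotent_right[OF assms(1) k] star_star by metis
  have "star (h * star x * h) = h * x * h"
    using h(1) by (simp add: star_mult star_idempotent mult.assoc)
  then show thesis
    using h that by simp
qed

lemma displaced_idempotent_below:
  fixes s t f g :: "'a::inverse_semigroup_with_zero"
  assumes qf: "quasi_fundamental TYPE('a)" and zd: "idempotents_zero_disjunctive TYPE('a)"
    and st: "star s * s = f" "star t * t = f"
    and g: "g \<in> idempotents" "g \<noteq> 0" "g * f = g"
    and ne: "\<And>e. e \<in> idempotents \<Longrightarrow> e \<noteq> 0 \<Longrightarrow> e * f = e \<Longrightarrow> s * e \<noteq> t * e"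
  obtains h where "h \<in> idempotents" "h \<noteq> 0" "h * g = h" "h * (star s * t) * h = 0"
proof -
  \<comment> \<open>The part of \<open>star s * t\<close> living under \<open>g\<close>. If it
    vanishes, \<open>h = g\<close> works; otherwise it displaces some idempotent.\<close>
  define v where "v = g * (star s * t) * g"
  have gv: "g * v = v" "v * g = v"
    using g(1) by (simp_all add: v_def mult.assoc idempotents_absorb idempotentsD)
  have hv: "h * (star s * t) * h = h * v * h" if "h \<in> idempotents" "h * g = h" for h
    using that g(1) unfolding v_def by (metis idempotents_commute mult.assoc)
  have gstar: "g * (star v * v) = star v * v"
    using gv g(1) by (metis mult.assoc star_idempotent star_mult)
  have "v = 0 \<or> v \<notin> centralizer idempotents"
  proof (rule ccontr)
    assume "\<not> ?thesis"
    then obtain e where e: "e \<in> idempotents" "e \<noteq> 0" "natural_le e v"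
      using qf unfolding quasi_fundamental_def by blast
    have ve: "e = v * e"
      using e by (simp add: natural_le_def star_idempotent idempotentsD mult.assoc)
    have ge: "g * e = e" "e * g = e"
      using ve gv g(1) e(1) by (metis mult.assoc idempotents_commute)+
    have ef: "e * f = e"
      using ge g(3) by (metis mult.assoc)
    have e': "e = g * (star s * t) * e"
      using ve ge by (simp add: v_def mult.assoc)
    \<comment> \<open>Were \<open>v\<close> nonzero and centralizing, it would fix a nonzero
      \<open>e\<close> below \<open>g\<close>. Then \<open>s * e\<close> is a restriction of
      \<open>t * e\<close>, both with domain \<open>e\<close>, so \<open>s\<close> and
      \<open>t\<close> agree on \<open>e\<close>.\<close>
    have "s * e = s * g * star s * (t * e)"
      by (subst e') (simp add: mult.assoc)
    moreover have "s * g * star s \<in> idempotents"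
      using g(1) by (rule conjugate_idempotent)
    moreover have "star (u * e) * (u * e) = e" if "star u * u = f" for u
    proof -
      have "star (u * e) * (u * e) = e * (star u * u) * e"
        using e(1) by (simp add: star_mult star_idempotent mult.assoc)
      then show ?thesis
        using that ef e(1) by (simp add: idempotentsD)
    qed
    ultimately have "s * e = t * e"
      using st by (metis eq_if_restriction)
    then show False
      using ne e ef by blast
  qed
  then show thesis
  proof
    assume "v = 0"
    then show thesis
      using that[of g] hv[of g] g by (simp add: idempotentsD)
  next
    assume "v \<notin> centralizer idempotents"
    then obtain k where "k \<in> idempotents" "v * k \<noteq> k * v"
      by (auto simp: centralizer_def)
    then obtain h where h: "h \<in> idempotents" "h \<noteq> 0" "h * v * h = 0"
      "h * (star v * v) = h \<or> h * (v * star v) = h"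
      using displaced_idempotent[OF zd] by metis
    \<comment> \<open>Domain and range of \<open>v\<close> both lie below \<open>g\<close>, and
      \<open>h\<close> lies below one of them.\<close>
    have "h * g = h"
      using h(1,4) g(1) gv gstar by (metis idempotents_commute mult.assoc)
    then show thesis
      using that h hv by simp
  qed
qed

text \<open>Treat the elements of \<open>A\<close> one at a time: passing to a smaller idempotent
  preserves the vanishing already obtained.\<close>

lemma displaced_idempotent_finite:
  fixes s f :: "'a::inverse_semigroup_with_zero"
  assumes qf: "quasi_fundamental TYPE('a)" and zd: "idempotents_zero_disjunctive TYPE('a)"
    and s: "star s * s = f"
    and f: "f \<in> idempotents" "f \<noteq> 0"
    and A: "finite A" "\<And>t. t \<in> A \<Longrightarrow> star t * t = f"
    and ne: "\<And>t e. t \<in> A \<Longrightarrow> e \<in> idempotents \<Longrightarrow> e \<noteq> 0 \<Longrightarrow> e * f = e \<Longrightarrow> s * e \<noteq> t * e"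
  obtains h where "h \<in> idempotents" "h \<noteq> 0" "h * f = h"
    "\<And>t. t \<in> A \<Longrightarrow> h * (star s * t) * h = 0"
proof -
  have "\<exists>h\<in>idempotents. h \<noteq> 0 \<and> h * f = h \<and> (\<forall>t\<in>A. h * (star s * t) * h = 0)"
    using A ne
  proof (induction A)
    case empty
    then show ?case
      using f by (auto simp: idempotentsD)
  next
    case (insert t A)
    then obtain g where g: "g \<in> idempotents" "g \<noteq> 0" "g * f = g"
      "\<forall>t\<in>A. g * (star s * t) * g = 0"
      by (metis insertCI)
    obtain h where h: "h \<in> idempotents" "h \<noteq> 0" "h * g = h" "h * (star s * t) * h = 0"
      using displaced_idempotent_below[OF qf zd s _ g(1-3)] insert.prems
      by (metis insertCI)
    have "h * (star s * u) * h = h * (g * (star s * u) * g) * h" for u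
      using h g(1) by (metis idempotents_commute mult.assoc)
    then have "\<forall>u\<in>A. h * (star s * u) * h = 0"
      using g(4) by simp
    moreover have "h * f = h"
      using h(3) g(3) by (metis mult.assoc)
    ultimately show ?case
      using h by auto
  qed
  then show thesis
    using that by blast
qed

section \<open>The singular ideal\<close>

lemma incl_eq_0_iff [simp]:
  "(incl s :: ('a::inverse_semigroup_with_zero, 'k::field) contracted_algebra) = 0 \<longleftrightarrow> s = 0"
proof
  assume "(incl s :: ('a, 'k) contracted_algebra) = 0"
  then have "coeff (incl s :: ('a, 'k) contracted_algebra) s = 0"
    by simp
  then show "s = 0"
    by (simp add: coeff_incl split: if_splits)
qed simp

lemma incl_eq_iff:
  "(incl s :: ('a::inverse_semigroup_with_zero, 'k::field) contracted_algebra) = incl t \<longleftrightarrow> s = t"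
proof
  assume eq: "(incl s :: ('a, 'k) contracted_algebra) = incl t"
  show "s = t"
  proof (cases "s = 0")
    case True
    then show ?thesis
      using eq by (metis incl_eq_0_iff)
  next
    case False
    then have "coeff (incl t :: ('a, 'k) contracted_algebra) s = 1"
      by (simp add: eq[symmetric] coeff_incl)
    then show ?thesis
      by (simp add: coeff_incl split: if_splits)
  qed
qed simp

lemma times_incl:
  "a * incl g = (\<Sum>s\<in>support a. scale (coeff a s) (incl (s * g)))"
proof -
  have "(\<Sum>s\<in>support a. scale (coeff a s) (incl s)) * incl g
      = (\<Sum>s\<in>support a. scale (coeff a s) (incl (s * g)))"
    by (simp add: contracted_sum_distrib contracted_scale_times incl_mult)
  then show ?thesis
    by (simp only: contracted_expand[symmetric])
qed

lemma support_times_incl: "support (a * incl g) \<subseteq> (\<lambda>s. s * g) ` support a - {0}"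
proof
  fix u
  assume u: "u \<in> support (a * incl g)"
  then have "(\<Sum>s\<in>support a. coeff a s * coeff (incl (s * g) :: ('a, 'b) contracted_algebra) u) \<noteq> 0"
    by (simp add: support_def times_incl coeff_sum)
  then obtain s where "s \<in> support a" "coeff (incl (s * g) :: ('a, 'b) contracted_algebra) u \<noteq> 0"
    by (metis (no_types, lifting) sum.neutral mult_zero_right)
  then show "u \<in> (\<lambda>s. s * g) ` support a - {0}"
    by (auto simp: coeff_incl split: if_splits)
qed

text \<open>The support of the product lies in the nonzero part of the image, so keeping its size
  leaves no room for two terms to merge or one to die.\<close>

lemma card_support_times_incl:
  assumes "card (support a) \<le> card (support (a * incl g))"
  shows "inj_on (\<lambda>s. s * g) (support a)" "0 \<notin> (\<lambda>s. s * g) ` support a"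
proof -
  let ?X = "(\<lambda>s. s * g) ` support a"
  have 1: "card (support a) \<le> card (?X - {0})"
    using assms card_mono[OF _ support_times_incl[of a g]] by simp
  also have "\<dots> \<le> card ?X"
    by (intro card_mono) auto
  finally have "card ?X = card (support a)"
    using card_image_le[of "support a" "\<lambda>s. s * g"] by simp
  then show "inj_on (\<lambda>s. s * g) (support a)"
    by (intro eq_card_imp_inj_on) auto
  show "0 \<notin> ?X"
  proof
    assume "0 \<in> ?X"
    then have "card (?X - {0}) < card ?X"
      by (intro psubset_card_mono) auto
    then show False
      using 1 \<open>card ?X = card (support a)\<close> by simp
  qed
qed

section \<open>Singular elements and ideals avoiding idempotents\<close>

lemma two_sided_idealD:
  assumes "two_sided_ideal J"
  shows "0 \<in> J" "x \<in> J \<Longrightarrow> a * x \<in> J" "x \<in> J \<Longrightarrow> x * a \<in> J" "x \<in> J \<Longrightarrow> scale c x \<in> J"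
    "x \<in> J \<Longrightarrow> y \<in> J \<Longrightarrow> x + y \<in> J" "x \<in> J \<Longrightarrow> y \<in> J \<Longrightarrow> x - y \<in> J"
  using assms unfolding two_sided_ideal_def
  by (auto intro: contracted_algebra.subspace_0 contracted_algebra.subspace_scale
      contracted_algebra.subspace_add contracted_algebra.subspace_diff)

lemma singularE:
  assumes "singular a" "e \<in> idempotents" "e \<noteq> 0"
  obtains f where "f \<in> idempotents" "f \<noteq> 0" "f * e = f" "a * incl f = 0"
  using assms unfolding singular_def by (metis natural_le_idempotents)

lemma singularI:
  assumes "\<And>e. e \<in> idempotents \<Longrightarrow> e \<noteq> 0 \<Longrightarrow>
    \<exists>f\<in>idempotents. f \<noteq> 0 \<and> f * e = f \<and> a * incl f = 0"
  shows "singular a"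
  using assms unfolding singular_def by (metis natural_le_idempotents)

lemma times_incl_below:
  fixes a :: "('a::inverse_semigroup_with_zero, 'k::field) contracted_algebra"
  assumes "a * incl f = 0" "e \<in> idempotents" "f \<in> idempotents" "e * f = e"
  shows "a * incl e = 0"
proof -
  have "a * incl e = a * incl f * incl e"
    using assms(2-4) idempotents_commute[of e f] by (simp add: mult.assoc incl_mult[symmetric])
  then show ?thesis
    using assms(1) by simp
qed

lemma singular_add:
  assumes "singular a" "singular b"
  shows "singular (a + b)"
proof (rule singularI)
  fix e :: 'a
  assume "e \<in> idempotents" "e \<noteq> 0"
  then obtain f where f: "f \<in> idempotents" "f \<noteq> 0" "f * e = f" "a * incl f = 0"
    using assms(1) singularE by blast
  then obtain g where g: "g \<in> idempotents" "g \<noteq> 0" "g * f = g" "b * incl g = 0"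
    using assms(2) singularE by blast
  have "g * e = g"
    using f(3) g(3) by (metis mult.assoc)
  moreover have "a * incl g = 0"
    using times_incl_below f g by blast
  ultimately show "\<exists>f\<in>idempotents. f \<noteq> 0 \<and> f * e = f \<and> (a + b) * incl f = 0"
    using g by (auto simp: distrib_right)
qed

text \<open>Transport along \<open>s\<close>: an \<open>f\<close> below
  \<open>s * e * star s\<close> annihilated by \<open>a\<close> pulls back to
  \<open>g = star s * f * s\<close> below \<open>e\<close>, and
  \<open>s * g = f * s\<close>.\<close>

lemma singular_times_incl:
  assumes "singular a"
  shows "singular (a * incl s)"
proof (rule singularI)
  fix e :: 'a
  assume e: "e \<in> idempotents" "e \<noteq> 0"
  show "\<exists>f\<in>idempotents. f \<noteq> 0 \<and> f * e = f \<and> a * incl s * incl f = 0"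
  proof (cases "s * e = 0")
    case True
    then have "a * incl s * incl e = 0"
      by (simp add: mult.assoc incl_mult[symmetric])
    then show ?thesis
      using e by (auto simp: idempotentsD)
  next
    case False
    then have "s * e * star s \<noteq> 0"
      using e by (simp add: conjugate_eq_0_iff)
    then obtain f where f: "f \<in> idempotents" "f \<noteq> 0" "f * (s * e * star s) = f" "a * incl f = 0"
      using assms singularE e conjugate_idempotent(1) by metis
    define g where "g = star s * f * s"
    have g: "g \<in> idempotents"
      unfolding g_def using f(1) by (rule conjugate_idempotent)
    have fss: "f * (s * star s) = f"
      using f(3) by (metis mult.assoc star_assoc(2))
    then have sg: "s * g = f * s"
      unfolding g_def using idempotents_commute[OF f(1), of "s * star s"]
      by (simp add: mult.assoc[symmetric])
    have fse: "f * s * e = f * s"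
    proof -
      have "f * s = f * (s * e * star s) * s"
        using f(3) by simp
      also have "\<dots> = f * s * (e * (star s * s))"
        by (simp add: mult.assoc)
      also have "\<dots> = f * s * (star s * s * e)"
        using idempotents_commute[OF e(1), of "star s * s"] by simp
      also have "\<dots> = f * s * e"
        by (simp add: mult.assoc star_assoc)
      finally show ?thesis
        by (rule sym)
    qed
    have "g \<noteq> 0"
      using sg fss f(2) by (metis mult.assoc mult_zero_left mult_zero_right)
    moreover have "g * e = g"
      using fse by (simp add: g_def mult.assoc)
    moreover have "a * incl s * incl g = a * incl f * incl s"
      using sg by (simp add: mult.assoc incl_mult[symmetric])
    ultimately show ?thesis
      using g f(4) by auto
  qed
qed

text \<open>Left multiplication keeps the same witnesses \<open>f\<close>; right multiplication
  reduces by linearity to a single \<open>incl s\<close>.\<close>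

lemma two_sided_ideal_singular_ideal:
  "two_sided_ideal (singular_ideal :: ('a::inverse_semigroup_with_zero, 'k::field) contracted_algebra set)"
proof -
  let ?I = "singular_ideal :: ('a, 'k) contracted_algebra set"
  have sub: "contracted_algebra.subspace ?I"
  proof (rule contracted_algebra.subspaceI)
    show "0 \<in> ?I"
      by (auto simp: singular_ideal_def idempotentsD intro!: singularI)
    show "x + y \<in> ?I" if "x \<in> ?I" "y \<in> ?I" for x y
      using that by (simp add: singular_ideal_def singular_add)
    show "scale c x \<in> ?I" if "x \<in> ?I" for c x
      using that by (fastforce simp: singular_ideal_def singular_def contracted_scale_times)
  qed
  have "a * x \<in> ?I" if "x \<in> ?I" for a x
    using that by (fastforce simp: singular_ideal_def singular_def mult.assoc)
  moreover have "x * a \<in> ?I" if "x \<in> ?I" for a x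
  proof -
    have "x * (\<Sum>s\<in>support a. scale (coeff a s) (incl s)) \<in> ?I"
      unfolding contracted_sum_distrib contracted_scale_times using that singular_times_incl
      by (intro contracted_algebra.subspace_sum contracted_algebra.subspace_scale sub)
        (simp add: singular_ideal_def)
    then show ?thesis
      by (simp only: contracted_expand[symmetric])
  qed
  ultimately show ?thesis
    using sub by (simp add: two_sided_ideal_def)
qed

text \<open>If \<open>a\<close> were not singular, choose \<open>f\<close> so that the support of \<open>a * incl f\<close> has minimal
  size. Then multiplication by idempotents below \<open>f\<close> never merges or kills support elements,
  which by 0-disjunctivity forces them all to have domain idempotent \<open>f\<close>. For \<open>s\<close> in the
  support, some \<open>h\<close> is displaced off itself by every other \<open>star s * t\<close>, so compressing
  \<open>incl (star s) * (a * incl f)\<close> by \<open>h\<close> leaves a nonzero multiple of \<open>incl h\<close> in \<open>J\<close>.\<close>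

lemma ideal_subset_singular_ideal:
  fixes J :: "('a::inverse_semigroup_with_zero, 'k::field) contracted_algebra set"
  assumes qf: "quasi_fundamental TYPE('a)" and zd: "idempotents_zero_disjunctive TYPE('a)"
    and J: "two_sided_ideal J" "J \<inter> incl ` idempotents = {0}"
  shows "J \<subseteq> singular_ideal"
proof
  fix a
  assume a: "a \<in> J"
  have "singular a"
  proof (rule singularI, rule ccontr)
    fix e :: 'a
    assume e: "e \<in> idempotents" "e \<noteq> 0"
      and ns: "\<not> (\<exists>f\<in>idempotents. f \<noteq> 0 \<and> f * e = f \<and> a * incl f = 0)"
    define P where "P f \<longleftrightarrow> f \<in> idempotents \<and> f \<noteq> 0 \<and> f * e = f" for f
    have "P e"
      using e by (simp add: P_def idempotentsD)
    then obtain f where f: "P f"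
      and min: "\<And>g. P g \<Longrightarrow> card (support (a * incl f)) \<le> card (support (a * incl g))"
      using exists_least_iff[of "\<lambda>n. \<exists>f. P f \<and> card (support (a * incl f)) = n"]
      by (metis linorder_not_le)
    define b where "b = a * incl f"
    have fI: "f \<in> idempotents" "f \<noteq> 0"
      using f by (simp_all add: P_def)
    have inj: "inj_on (\<lambda>s. s * g) (support b)" "0 \<notin> (\<lambda>s. s * g) ` support b"
      if g: "g \<in> idempotents" "g \<noteq> 0" "g * f = g" for g
    proof -
      have "P g"
        using g f unfolding P_def by (metis mult.assoc)
      moreover have "b * incl g = a * incl g"
        using g fI(1) idempotents_commute[of g f]
        by (simp add: b_def mult.assoc incl_mult[symmetric])
      ultimately have "card (support b) \<le> card (support (b * incl g))"
        using min b_def by simp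
      then show "inj_on (\<lambda>s. s * g) (support b)" "0 \<notin> (\<lambda>s. s * g) ` support b"
        using card_support_times_incl by blast+
    qed
    have dom: "star s * s = f" if s: "s \<in> support b" for s
    proof -
      have "s * f = s"
        using s support_times_incl[of a f] fI(1) by (auto simp: b_def mult.assoc idempotentsD)
      then have sf: "star s * s * f = star s * s"
        by (simp add: mult.assoc)
      have "star s * s * f = f"
      proof (rule ccontr)
        \<comment> \<open>A nonzero \<open>g\<close> below \<open>f\<close> and orthogonal to the
          domain of \<open>s\<close> would kill the term \<open>s\<close>, against
          minimality.\<close>
        assume "star s * s * f \<noteq> f"
        then obtain g where g: "g \<in> idempotents" "g \<noteq> 0" "g * f = g" "star s * s * g = 0"
          using zero_disjunctiveE[OF zd fI(1)] star_mult_idempotent(1) by metis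
        then have "s * g = 0"
          by (metis mult.assoc mult_zero_right star_inverse(1))
        then show False
          using inj(2)[OF g(1-3)] s by (metis image_eqI)
      qed
      then show ?thesis
        using sf by simp
    qed
    have "b \<noteq> 0"
      using ns f by (auto simp: b_def P_def)
    then obtain s where s: "s \<in> support b"
      using coeff_eqI[of b 0] by (auto simp: support_def)
    obtain h where h: "h \<in> idempotents" "h \<noteq> 0" "h * f = h"
      "\<And>t. t \<in> support b - {s} \<Longrightarrow> h * (star s * t) * h = 0"
    proof (rule displaced_idempotent_finite[OF qf zd dom[OF s] fI, of "support b - {s}"])
      fix t g
      assume "t \<in> support b - {s}" "g \<in> idempotents" "g \<noteq> 0" "g * f = g"
      then show "s * g \<noteq> t * g"
        using inj(1)[of g] s by (auto dest: inj_onD)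
    qed (use dom in auto)
    have "incl (h * star s) * (b * incl h)
        = (\<Sum>t\<in>support b. scale (coeff b t) (incl (h * (star s * t) * h)))"
      by (simp add: times_incl[of b] contracted_sum_distrib contracted_scale_times incl_mult[symmetric]
          mult.assoc)
    \<comment> \<open>The choice of \<open>h\<close> kills every other term, while
      \<open>star s * s = f\<close> lies above \<open>h\<close>.\<close>
    also have "\<dots> = (\<Sum>t\<in>{s}. scale (coeff b t) (incl (h * (star s * t) * h)))"
      using s h(4) by (intro sum.mono_neutral_right) auto
    also have "\<dots> = scale (coeff b s) (incl h)"
      using dom[OF s] h by (simp add: idempotentsD)
    finally have "scale (coeff b s) (incl h) \<in> J"
      using a J(1) by (metis b_def two_sided_idealD(2,3))
    then have "scale (inverse (coeff b s)) (scale (coeff b s) (incl h)) \<in> J"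
      using J(1) by (rule two_sided_idealD(4)[rotated])
    then have "incl h \<in> J"
      using s by (simp add: support_def)
    then have "(incl h :: ('a, 'k) contracted_algebra) = 0"
      using J(2) h(1) by blast
    then show False
      using h(2) by simp
  qed
  then show "a \<in> singular_ideal"
    by (simp add: singular_ideal_def)
qed

section \<open>Comparison of the conditions on an ideal\<close>

lemma singular_ideal_inter_idempotents:
  assumes "incl e \<in> singular_ideal" "e \<in> idempotents"
  shows "e = 0"
proof (rule ccontr)
  assume "e \<noteq> 0"
  then obtain f where f: "f \<in> idempotents" "f \<noteq> 0" "f * e = f"
    "(incl e :: ('a, 'b) contracted_algebra) * incl f = 0"
    using assms singularE unfolding singular_ideal_def by blast
  then have "e * f = 0"
    by (simp add: incl_mult[symmetric])
  then show False
    using f assms(2) idempotents_commute by metis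
qed

lemma inter_idempotents_eqI:
  fixes J :: "('a::inverse_semigroup_with_zero, 'k::field) contracted_algebra set"
  assumes "two_sided_ideal J" "\<And>e. incl e \<in> J \<Longrightarrow> e \<in> idempotents \<Longrightarrow> e = 0"
  shows "J \<inter> incl ` idempotents = {0}"
proof -
  have "0 \<in> incl ` idempotents"
    by (rule image_eqI[of _ _ 0]) auto
  then show ?thesis
    using assms(2) two_sided_idealD(1)[OF assms(1)] by auto
qed

text \<open>An \<open>s\<close> in \<open>J\<close> puts \<open>star s * s\<close> into
  \<open>J\<close>, and if that idempotent is zero then so is
  \<open>s = s * (star s * s)\<close>.\<close>

lemma ideal_inter_idempotents_iff:
  fixes J :: "('a::inverse_semigroup_with_zero, 'k::field) contracted_algebra set"
  assumes "two_sided_ideal J"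
  shows "J \<inter> range incl = {0} \<longleftrightarrow> J \<inter> incl ` idempotents = {0}"
proof
  have z: "0 \<in> incl ` idempotents"
    by (rule image_eqI[of _ _ 0]) auto
  show "J \<inter> incl ` idempotents = {0}" if "J \<inter> range incl = {0}"
    using that z two_sided_idealD(1)[OF assms] by blast
  assume E: "J \<inter> incl ` idempotents = {0}"
  have "incl s = (0 :: ('a, 'k) contracted_algebra)" if "incl s \<in> J" for s
  proof -
    have "incl (star s * s) \<in> J"
      using that assms by (simp add: incl_mult two_sided_idealD)
    then have "(incl (star s * s) :: ('a, 'k) contracted_algebra) = 0"
      using E star_mult_idempotent(1) by blast
    then have "s * (star s * s) = 0"
      by simp
    then show ?thesis
      by (simp add: star_assoc)
  qed
  then show "J \<inter> range incl = {0}"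
    using z two_sided_idealD(1)[OF assms] by auto
qed

lemma canonical_map_eq_iff:
  fixes J :: "('a::inverse_semigroup_with_zero, 'k::field) contracted_algebra set"
  assumes "two_sided_ideal J"
  shows "canonical_map J s = canonical_map J t \<longleftrightarrow> incl s - incl t \<in> J"
proof
  assume "canonical_map J s = canonical_map J t"
  then have "incl s + 0 \<in> incl t +o J"
    using two_sided_idealD(1)[OF assms] unfolding canonical_map_def by blast
  then show "incl s - incl t \<in> J"
    by (auto simp: elt_set_plus_def)
next
  have sub: "incl u +o J \<subseteq> incl v +o J" if "incl u - incl v \<in> J" for u v
  proof
    fix x
    assume "x \<in> incl u +o J"
    then obtain y where y: "y \<in> J" "x = incl v + ((incl u - incl v) + y)"
      by (auto simp: elt_set_plus_def)
    show "x \<in> incl v +o J"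
      unfolding y(2) using that y(1) two_sided_idealD(5)[OF assms] by (intro set_plus_intro2) blast
  qed
  assume st: "incl s - incl t \<in> J"
  then have "incl t - incl s \<in> J"
    using two_sided_idealD(1,6)[OF assms] by (metis diff_0 minus_diff_eq)
  then show "canonical_map J s = canonical_map J t"
    using st sub unfolding canonical_map_def by blast
qed

text \<open>Elements congruent modulo the singular ideal agree on a dense set of idempotents, which
  forces first their domains to coincide and then \<open>star s * t\<close> to centralize the idempotents.\<close>

lemma singular_diff_imp_eq:
  fixes s t :: "'a::inverse_semigroup_with_zero"
  assumes fund: "fundamental TYPE('a)" and zd: "idempotents_zero_disjunctive TYPE('a)"
    and sing: "singular (incl s - incl t :: ('a, 'k::field) contracted_algebra)"
  shows "s = t"
proof -
  have dense: "\<exists>f\<in>idempotents. f \<noteq> 0 \<and> f * e = f \<and> s * f = t * f"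
    if e: "e \<in> idempotents" "e \<noteq> 0" for e
  proof -
    obtain f where f: "f \<in> idempotents" "f \<noteq> 0" "f * e = f"
      "(incl s - incl t :: ('a, 'k) contracted_algebra) * incl f = 0"
      using singularE[OF sing e] by blast
    then have "(incl (s * f) :: ('a, 'k) contracted_algebra) = incl (t * f)"
      by (simp add: left_diff_distrib incl_mult)
    then show ?thesis
      using f by (auto simp: incl_eq_iff)
  qed
  \<comment> \<open>Otherwise some nonzero \<open>g\<close> below the domain of \<open>u\<close> is
    orthogonal to that of \<open>v\<close>, and agreement on an \<open>f\<close> below
    \<open>g\<close> gives \<open>u * f = 0\<close>. Stated for general \<open>u\<close> and
    \<open>v\<close> to serve in both directions.\<close>
  have dom_le: "star v * v * (star u * u) = star u * u"
    if uv: "\<And>e. e \<in> idempotents \<Longrightarrow> e \<noteq> 0 \<Longrightarrow> \<exists>f\<in>idempotents. f \<noteq> 0 \<and> f * e = f \<and> u * f = v * f"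
    for u v :: 'a
  proof (rule ccontr)
    assume "star v * v * (star u * u) \<noteq> star u * u"
    then obtain g where g: "g \<in> idempotents" "g \<noteq> 0" "g * (star u * u) = g" "star v * v * g = 0"
      using zero_disjunctiveE[OF zd] star_mult_idempotent(1) by metis
    then obtain f where f: "f \<in> idempotents" "f \<noteq> 0" "f * g = f" "u * f = v * f"
      using uv by blast
    have "v * g = 0"
      using g(4) by (metis mult.assoc mult_zero_right star_inverse(1))
    then have "u * f = 0"
      using f g(1) by (metis idempotents_commute mult.assoc mult_zero_left)
    moreover have "star u * u * f = f"
      using f(1,3) g(1,3) by (metis idempotents_commute mult.assoc star_mult_idempotent(1))
    ultimately show False
      using f(2) by (simp add: mult.assoc)
  qed
  have "star t * t * (star s * s) = star s * s"
    using dense by (rule dom_le)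
  moreover have "star s * s * (star t * t) = star t * t"
    by (rule dom_le) (use dense in metis)
  ultimately have dom: "star s * s = star t * t"
    by (metis idempotents_commute star_mult_idempotent(1))
  define e where "e = star s * s"
  define x where "x = star s * t"
  have e: "e \<in> idempotents"
    by (simp add: e_def)
  have fixes_dense: "\<exists>f\<in>idempotents. f \<noteq> 0 \<and> f * g = f \<and> x * f = f"
    if g: "g \<in> idempotents" "g \<noteq> 0" "g * e = g" for g
  proof -
    obtain f where f: "f \<in> idempotents" "f \<noteq> 0" "f * g = f" "s * f = t * f"
      using dense g by blast
    have "x * f = e * f"
      using f(4) by (simp add: x_def e_def mult.assoc)
    also have "\<dots> = f"
      using f(1,3) g(3) e by (metis idempotents_commute mult.assoc)
    finally show ?thesis
      using f by blast
  qed
  have xe: "x * e = x" "e * x = x"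
    by (simp add: x_def e_def dom mult.assoc star_assoc)
      (simp add: x_def e_def mult.assoc star_assoc)
  have "x \<in> centralizer idempotents"
  proof (rule ccontr)
    assume "x \<notin> centralizer idempotents"
    then obtain k where "k \<in> idempotents" "x * k \<noteq> k * x"
      by (auto simp: centralizer_def)
    then obtain h where h: "h \<in> idempotents" "h \<noteq> 0" "h * x * h = 0"
      "h * (star x * x) = h \<or> h * (x * star x) = h"
      using displaced_idempotent[OF zd] by metis
    have "h * e = h"
      using h(1,4) e xe by (metis idempotents_commute mult.assoc star_mult_idempotent(2))
    then obtain f where f: "f \<in> idempotents" "f \<noteq> 0" "f * h = f" "x * f = f"
      using fixes_dense h by blast
    \<comment> \<open>\<open>x\<close> fixes \<open>f\<close>, yet displaces \<open>h\<close>, which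
      lies above \<open>f\<close>.\<close>
    have "f = f * (h * x * h) * f"
      using f h(1) by (metis idempotents_commute idempotentsD mult.assoc)
    then show False
      using f(2) h(3) by simp
  qed
  then have x: "x \<in> idempotents"
    using fund by (simp add: fundamental_def)
  \<comment> \<open>\<open>x\<close> fixes a nonzero idempotent below each nonzero \<open>g\<close>
    under \<open>e\<close>, so no such \<open>g\<close> is orthogonal to \<open>x\<close>.\<close>
  have "x * e = e"
  proof (rule ccontr)
    assume "x * e \<noteq> e"
    then obtain g where g: "g \<in> idempotents" "g \<noteq> 0" "g * e = g" "x * g = 0"
      using zero_disjunctiveE[OF zd e x] by blast
    then obtain f where f: "f \<in> idempotents" "f \<noteq> 0" "f * g = f" "x * f = f"
      using fixes_dense by blast
    have "x * f = x * g * f"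
      using f g(1) by (metis idempotents_commute mult.assoc)
    then show False
      using f g(4) by simp
  qed
  then have "star s * t = star s * s"
    using xe by (simp add: x_def e_def)
  then have "s = s * star s * t"
    by (simp add: mult.assoc star_assoc)
  then show ?thesis
    using dom eq_if_restriction star_mult_idempotent(2) by blast
qed

theorem theorem3p7:
  fixes I :: "('a::inverse_semigroup_with_zero, 'k::field) contracted_algebra set"
  assumes "quasi_fundamental TYPE('a)"
    and "idempotents_zero_disjunctive TYPE('a)"
    and "I = singular_ideal"
  shows "(\<forall>J :: ('a, 'k) contracted_algebra set. two_sided_ideal J \<longrightarrow>
            (J \<inter> range incl = {0} \<longleftrightarrow> J \<inter> incl ` idempotents = {0}) \<and>
            (J \<inter> incl ` idempotents = {0} \<longleftrightarrow> J \<subseteq> I)) \<and>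
         (fundamental TYPE('a) \<longrightarrow>
            (\<forall>J :: ('a, 'k) contracted_algebra set. two_sided_ideal J \<longrightarrow>
               (J \<subseteq> I \<longleftrightarrow> inj (canonical_map J)) \<and>
               (inj (canonical_map J) \<longleftrightarrow> inj_on (canonical_map J) idempotents)) \<and>
            (\<forall>M :: ('a, 'k) contracted_algebra set.
               (two_sided_ideal M \<and> inj (canonical_map M) \<and>
                (\<forall>J. two_sided_ideal J \<and> inj (canonical_map J) \<longrightarrow> J \<subseteq> M))
               \<longleftrightarrow> M = I))"
proof -
  have qf: "quasi_fundamental TYPE('a)" and zd: "idempotents_zero_disjunctive TYPE('a)"
    and I: "I = singular_ideal"
    using assms by blast+
  have I_ideal: "two_sided_ideal I"
    unfolding I by (rule two_sided_ideal_singular_ideal)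
  have 23: "J \<inter> incl ` idempotents = {0} \<longleftrightarrow> J \<subseteq> I"
    if J: "two_sided_ideal J" for J :: "('a, 'k) contracted_algebra set"
  proof
    show "J \<subseteq> I" if "J \<inter> incl ` idempotents = {0}"
      unfolding I using ideal_subset_singular_ideal[OF qf zd J that] .
    assume "J \<subseteq> I"
    then have "e = 0" if "incl e \<in> J" "e \<in> idempotents" for e
      using that singular_ideal_inter_idempotents unfolding I by blast
    then show "J \<inter> incl ` idempotents = {0}"
      using J by (intro inter_idempotents_eqI)
  qed
  have 34: "inj (canonical_map J)"
    if "fundamental TYPE('a)" "two_sided_ideal J" "J \<subseteq> I"
    for J :: "('a, 'k) contracted_algebra set"
  proof (rule injI)
    fix s t
    assume "canonical_map J s = canonical_map J t"
    then have "incl s - incl t \<in> I"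
      using that(2,3) canonical_map_eq_iff by blast
    then have "singular (incl s - incl t :: ('a, 'k) contracted_algebra)"
      by (simp add: I singular_ideal_def)
    then show "s = t"
      using that(1) zd singular_diff_imp_eq by blast
  qed
  have 52: "J \<inter> incl ` idempotents = {0}"
    if J: "two_sided_ideal J" and inj: "inj_on (canonical_map J) idempotents"
    for J :: "('a, 'k) contracted_algebra set"
  proof -
    have "e = 0" if "incl e \<in> J" "e \<in> idempotents" for e
      using that inj_onD[OF inj, of e 0] by (simp add: canonical_map_eq_iff[OF J])
    then show ?thesis
      using J by (intro inter_idempotents_eqI)
  qed
  have 45: "inj_on (canonical_map J) idempotents" if "inj (canonical_map J)"
    for J :: "('a, 'k) contracted_algebra set"
    using that by (rule inj_on_subset) simp
  have equiv: "(J \<subseteq> I \<longleftrightarrow> inj (canonical_map J)) \<and>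
      (inj (canonical_map J) \<longleftrightarrow> inj_on (canonical_map J) idempotents)"
    if fund: "fundamental TYPE('a)" and J: "two_sided_ideal J" for J :: "('a, 'k) contracted_algebra set"
    \<comment> \<open>The implications close a cycle: containment in \<open>I\<close>, injectivity
      on all elements, injectivity on idempotents, trivial intersection with the idempotents, and
      containment again.\<close>
    using 23[OF J] 34[OF fund J] 45[of J] 52[OF J] by argo
  have largest: "two_sided_ideal M \<and> inj (canonical_map M) \<and>
      (\<forall>J. two_sided_ideal J \<and> inj (canonical_map J) \<longrightarrow> J \<subseteq> M) \<longleftrightarrow> M = I"
    if fund: "fundamental TYPE('a)" for M :: "('a, 'k) contracted_algebra set"
  proof -
    have "two_sided_ideal J \<and> inj (canonical_map J) \<longleftrightarrow> two_sided_ideal J \<and> J \<subseteq> I"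
      for J :: "('a, 'k) contracted_algebra set"
      using equiv[OF fund, of J] by argo
    then show ?thesis
      \<comment> \<open>The ideals with injective canonical map are exactly those inside
        \<open>I\<close>, and \<open>I\<close> is one of them.\<close>
      using I_ideal by (metis order_refl subset_antisym)
  qed
  show ?thesis
    by (intro conjI allI impI ideal_inter_idempotents_iff 23 largest
        equiv[THEN conjunct1] equiv[THEN conjunct2])
qed

end
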